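(* Let $r,k,t$ be positive integers with $t\le r$, and let $\mathcal H$ be an $r$-uniform $r$-partite $k$-wise $t$-intersecting hypergraph. If $k\ge 3$ and $t\ge 1$, or $k=2$ and $t>\frac r3$, then \[ \tau(\mathcal H)\le \left\lfloor \frac{r-t}{k}\right\rfloor + 1, \] and this bound is best possible: for such $r,k,t$ there exists an $r$-uniform $r$-partite $k$-wise $t$-intersecting hypergraph $\mathcal H$ with $\tau(\mathcal H)=\lfloor (r-t)/k\rfloor+1$.
   Context: All hypergraphs are finite. An $r$-uniform hypergraph $\mathcal H$ is $r$-partite if its vertex set can be partitioned as $V(\mathcal H)=P_1\sqcup\dots\sqcup P_r$ such that $|e\cap P_j|=1$ for every edge $e$ and every $j\in[r]$. A hypergraph is $k$-wise $t$-intersecting if for any edges $e_1,\dots,e_k\in E(\mathcal H)$ we have $|e_1\cap\dots\cap e_k|\ge t$. A cover of $\mathcal H$ is a set $C\subseteq V(\mathcal H)$ with $C\cap e\neq\emptyset$ for every edge $e$; the cover number $\tau(\mathcal H)$ is the minimum size of a cover. *)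

theory Defs
  imports Complex_Main "HOL-Library.Disjoint_Sets"
begin

definition hypergraph :: "'a set \<Rightarrow> 'a set set \<Rightarrow> bool" where
  "hypergraph V E \<longleftrightarrow> finite V \<and> (\<forall>e\<in>E. e \<subseteq> V)"

definition uniform :: "nat \<Rightarrow> 'a set set \<Rightarrow> bool" where
  "uniform r E \<longleftrightarrow> (\<forall>e\<in>E. card e = r)"

text \<open>The parts are indexed by \<open>1, \<dots>, r\<close> and may be empty; this only matters when \<open>E\<close> is empty.\<close>
definition partite :: "nat \<Rightarrow> 'a set \<Rightarrow> 'a set set \<Rightarrow> bool" where
  "partite r V E \<longleftrightarrow>
     (\<exists>P :: nat \<Rightarrow> 'a set.
        V = (\<Union>j\<in>{1..r}. P j) \<and> disjoint_family_on P {1..r} \<and>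
        (\<forall>e\<in>E. \<forall>j\<in>{1..r}. card (e \<inter> P j) = 1))"

text \<open>The \<open>k\<close> edges need not be distinct. For \<open>k = 0\<close> the intersection is \<open>UNIV\<close>, so the
  definition is only meaningful for \<open>k > 0\<close>.\<close>
definition wise_intersecting :: "nat \<Rightarrow> nat \<Rightarrow> 'a set set \<Rightarrow> bool" where
  "wise_intersecting k t E \<longleftrightarrow>
     (\<forall>e :: nat \<Rightarrow> 'a set. (\<forall>i\<in>{1..k}. e i \<in> E) \<longrightarrow> t \<le> card (\<Inter>i\<in>{1..k}. e i))"

definition cover :: "'a set \<Rightarrow> 'a set set \<Rightarrow> 'a set \<Rightarrow> bool" where
  "cover V E C \<longleftrightarrow> C \<subseteq> V \<and> (\<forall>e\<in>E. C \<inter> e \<noteq> {})"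

text \<open>Covers exist as soon as \<open>E\<close> consists of nonempty subsets of \<open>V\<close>; otherwise the value is
  unspecified.\<close>
definition cover_number :: "'a set \<Rightarrow> 'a set set \<Rightarrow> nat" where
  "cover_number V E = (LEAST n. \<exists>C. cover V E C \<and> card C = n)"

end

theory Submission
  imports Defs "HOL-Library.Nat_Bijection"
begin

text \<open>
  Upper bound. Choose \<open>j \<ge> 2\<close> edges whose intersection \<open>A\<close> has minimum size \<open>s\<close>, and let \<open>h\<close> be
  any edge. Replacing the \<open>i\<close>-th edge by \<open>h\<close> does not shrink the intersection, so \<open>h\<close> contains at
  least \<open>s - |h \<inter> A|\<close> vertices lying in all chosen edges except the \<open>i\<close>-th. For different \<open>i\<close>
  these vertices are different, and they lie in parts not met by \<open>A\<close>; hence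
  \<open>j (s - |h \<inter> A|) \<le> r - s\<close>, and any \<open>\<lfloor>(r - s) / j\<rfloor> + 1\<close> vertices of \<open>A\<close> form a cover once \<open>A\<close> has
  that many. For \<open>k = 2\<close> take \<open>j = 2\<close>. For \<open>k \<ge> 3\<close> take \<open>j = k - 1\<close>: if \<open>s - t \<le> (r - t) / k\<close>, then any
  \<open>s - t + 1\<close> vertices of \<open>A\<close> form a cover because \<open>|h \<inter> A| \<ge> t\<close>, and otherwise
  \<open>(r - s) / (k - 1) < (r - t) / k\<close>.

  Sharpness. With \<open>m = \<lfloor>(r - t) / k\<rfloor>\<close>, take all words of length \<open>r\<close> over \<open>{0, \<dots>, m + 1}\<close> having at
  most \<open>m\<close> nonzero letters; \<open>m\<close> vertices are always avoided by such a word.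
\<close>

section \<open>Upper bound: covers inside a minimal intersection\<close>

lemma partite_part_function:
  assumes "partite r V E" "hypergraph V E"
  obtains p where "\<And>e. e \<in> E \<Longrightarrow> inj_on p e" "\<And>e. e \<in> E \<Longrightarrow> p ` e \<subseteq> {1..r}"
proof -
  obtain P where V: "V = (\<Union>j\<in>{1..r}. P j)"
    and one: "\<And>e j. e \<in> E \<Longrightarrow> j \<in> {1..r} \<Longrightarrow> card (e \<inter> P j) = 1"
    using assms(1) unfolding partite_def by blast
  \<comment> \<open>Part labels turn counting the parts met by a set inside an edge into counting an
    image in \<open>{1..r}\<close>.\<close>
  define p where "p v = (SOME j. j \<in> {1..r} \<and> v \<in> P j)" for v
  have p: "p v \<in> {1..r} \<and> v \<in> P (p v)" if "e \<in> E" "v \<in> e" for e v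
  proof -
    have "\<exists>j. j \<in> {1..r} \<and> v \<in> P j"
      using that assms(2) V unfolding hypergraph_def by blast
    then show ?thesis unfolding p_def by (rule someI_ex)
  qed
  show thesis
  proof (rule that)
    fix e assume e: "e \<in> E"
    show "inj_on p e"
    proof (rule inj_onI)
      fix x y assume xy: "x \<in> e" "y \<in> e" "p x = p y"
      have "card (e \<inter> P (p x)) = 1" using one e p xy(1) by blast
      moreover have "x \<in> e \<inter> P (p x)" "y \<in> e \<inter> P (p x)"
        using p[OF e xy(1)] p[OF e xy(2)] xy by auto
      ultimately show "x = y" by (metis card_1_singletonE singletonD)
    qed
    show "p ` e \<subseteq> {1..r}" using p e by blast
  qed
qed

lemma minimal_family_exists:
  fixes E :: "'a set set"
  assumes "E \<noteq> {}"
  obtains e :: "nat \<Rightarrow> 'a set" where "\<And>i. i \<in> I \<Longrightarrow> e i \<in> E"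
    "\<And>f. (\<And>i. i \<in> I \<Longrightarrow> f i \<in> E) \<Longrightarrow> card (\<Inter>i\<in>I. e i) \<le> card (\<Inter>i\<in>I. f i)"
proof -
  obtain e0 where "e0 \<in> E" using assms by blast
  then have "\<forall>i\<in>I. (\<lambda>_. e0) i \<in> E" by simp
  then have "\<exists>e. (\<forall>i\<in>I. e i \<in> E) \<and>
      (\<forall>f. (\<forall>i\<in>I. f i \<in> E) \<longrightarrow> card (\<Inter>i\<in>I. e i) \<le> card (\<Inter>i\<in>I. f i))"
    using ex_has_least_nat[of "\<lambda>e. \<forall>i\<in>I. e i \<in> E" "\<lambda>_. e0" "\<lambda>e. card (\<Inter>i\<in>I. e i)"]
    by simp
  then show thesis using that by blast
qed

lemma minimal_family_edge_overlap:
  fixes e :: "'i \<Rightarrow> 'a set" and p :: "'a \<Rightarrow> nat"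
  assumes inj: "\<And>f. f \<in> E \<Longrightarrow> inj_on p f" and img: "\<And>f. f \<in> E \<Longrightarrow> p ` f \<subseteq> {1..r}"
    and fin: "\<And>f. f \<in> E \<Longrightarrow> finite f"
    and I: "finite I" "card I \<ge> 2" and eE: "\<And>i. i \<in> I \<Longrightarrow> e i \<in> E"
    and min: "\<And>f. (\<And>i. i \<in> I \<Longrightarrow> f i \<in> E) \<Longrightarrow> card (\<Inter>i\<in>I. e i) \<le> card (\<Inter>i\<in>I. f i)"
    and h: "h \<in> E" and A: "A = (\<Inter>i\<in>I. e i)"
  shows "card I * (card A - card (h \<inter> A)) \<le> r - card A"
proof -
  \<comment> \<open>The vertices that the intersection gains when \<open>h\<close> replaces
    \<open>e i\<close>: they lie in every \<open>e l\<close> except \<open>e i\<close>, so the sets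
    \<open>B i\<close> are pairwise disjoint.\<close>
  define B where "B i = (h \<inter> (\<Inter>l\<in>I - {i}. e l)) - A" for i
  have other: "\<exists>l\<in>I. l \<noteq> i" for i
  proof (rule ccontr)
    assume "\<not> ?thesis"
    then have "card I \<le> card {i}" by (intro card_mono) auto
    then show False using I by simp
  qed
  then obtain i0 where i0: "i0 \<in> I" by blast
  have Asub: "A \<subseteq> e i" if "i \<in> I" for i using that A by blast
  have finB: "finite (B i)" for i unfolding B_def using fin[OF h] by auto
  have swap: "card A - card (h \<inter> A) \<le> card (B i)" if i: "i \<in> I" for i
  proof -
    have "card A \<le> card (\<Inter>l\<in>I. (e(i := h)) l)"
      unfolding A by (rule min) (use eE h in auto)
    also have "(\<Inter>l\<in>I. (e(i := h)) l) = h \<inter> (\<Inter>l\<in>I - {i}. e l)"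
      using i by (auto split: if_splits)
    also have "\<dots> = (h \<inter> A) \<union> B i" unfolding B_def A by auto
    also have "card \<dots> \<le> card (h \<inter> A) + card (B i)" by (rule card_Un_le)
    finally show ?thesis by simp
  qed
  have disj: "B i \<inter> B l = {}" if "i \<in> I" "l \<in> I" "i \<noteq> l" for i l
    using that unfolding B_def A by blast
  define U where "U = (\<Union>i\<in>I. B i)"
  have Uh: "U \<subseteq> h" unfolding U_def B_def by auto
  have finA: "finite A" using Asub[OF i0] fin[OF eE[OF i0]] finite_subset by blast
  have pA: "p ` A \<subseteq> {1..r}" using Asub[OF i0] img[OF eE[OF i0]] by blast
  have cpA: "card (p ` A) = card A"
    using inj[OF eE[OF i0]] Asub[OF i0] by (meson card_image inj_on_subset)
  have pU: "p ` U \<subseteq> {1..r} - p ` A"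
  proof
    fix y assume "y \<in> p ` U"
    then obtain v i where v: "y = p v" "v \<in> B i" "i \<in> I" unfolding U_def by blast
    \<comment> \<open>Both \<open>v\<close> and \<open>A\<close> lie in the edge \<open>e l\<close>,
      on which \<open>p\<close> is injective; so \<open>v\<close>, being outside \<open>A\<close>,
      cannot share a part with a vertex of \<open>A\<close>.\<close>
    obtain l where l: "l \<in> I" "l \<noteq> i" using other by blast
    have vl: "v \<in> e l" "v \<in> h" "v \<notin> A" using v l unfolding B_def by auto
    have "p v \<notin> p ` A"
    proof
      assume "p v \<in> p ` A"
      then obtain a where "a \<in> A" "p v = p a" by blast
      then show False using inj[OF eE[OF l(1)]] Asub[OF l(1)] vl by (metis inj_onD subsetD)
    qed
    moreover have "p v \<in> {1..r}" using img[OF h] vl(2) by blast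
    ultimately show "y \<in> {1..r} - p ` A" unfolding v(1) by blast
  qed
  have "card I * (card A - card (h \<inter> A)) \<le> (\<Sum>i\<in>I. card (B i))"
    using sum_bounded_below[of I "card A - card (h \<inter> A)" "\<lambda>i. card (B i)"] swap by simp
  also have "\<dots> = card U"
    unfolding U_def using I(1) finB disj by (subst card_UN_disjoint) auto
  also have "\<dots> = card (p ` U)"
    using inj[OF h] Uh by (metis card_image inj_on_subset)
  also have "\<dots> \<le> card ({1..r} - p ` A)" using pU by (intro card_mono) auto
  also have "\<dots> = r - card A" using pA cpA finA by (subst card_Diff_subset) auto
  finally show ?thesis .
qed

text \<open>Only \<open>c - 1\<close> vertices of \<open>A\<close> lie outside \<open>C\<close>, too
  few to contain \<open>h \<inter> A\<close>.\<close>

lemma cover_from_overlap: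
  assumes "A \<subseteq> V" "finite A" "c \<ge> 1" "c \<le> card A" "\<And>h. h \<in> E \<Longrightarrow> c \<le> card (h \<inter> A)"
  obtains C where "cover V E C" "card C = card A - c + 1"
proof -
  have "card A - c + 1 \<le> card A" using assms by simp
  then obtain C where C: "C \<subseteq> A" "card C = card A - c + 1"
    by (rule obtain_subset_with_card_n)
  have "C \<inter> h \<noteq> {}" if h: "h \<in> E" for h
  proof
    assume "C \<inter> h = {}"
    then have "card C + card (h \<inter> A) = card (C \<union> (h \<inter> A))"
      using C assms(2) by (subst card_Un_disjoint) (auto intro: finite_subset)
    also have "\<dots> \<le> card A" using C assms(2) by (intro card_mono) auto
    finally show False using C(2) assms(4) assms(5)[OF h] by simp
  qed
  then have "cover V E C" using C(1) assms(1) by (auto simp: cover_def)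
  then show thesis using C(2) by (rule that)
qed

lemma small_cover_exists:
  fixes E :: "'a set set"
  assumes kt: "t > 0" "t \<le> r" "k \<ge> 3 \<or> (k = 2 \<and> r < 3 * t)"
    and H: "hypergraph V E" "partite r V E" "wise_intersecting k t E"
  obtains C where "cover V E C" "card C \<le> (r - t) div k + 1"
proof (cases "E = {}")
  case True
  then show thesis using that[of "{}"] by (simp add: cover_def)
next
  case False
  note found = that
  obtain p :: "'a \<Rightarrow> nat" where p: "\<And>e. e \<in> E \<Longrightarrow> inj_on p e" "\<And>e. e \<in> E \<Longrightarrow> p ` e \<subseteq> {1..r}"
    using partite_part_function[OF H(2,1)] by blast
  have fin: "finite f" if "f \<in> E" for f
    using that H(1) unfolding hypergraph_def by (meson finite_subset)
  \<comment> \<open>For \<open>k \<ge> 3\<close> one of the \<open>k\<close> slots stays free for an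
    arbitrary edge. For \<open>k = 2\<close> that would leave a single edge, while the exchange
    argument needs two.\<close>
  define j where "j = (if k = 2 then 2 else k - 1)"
  have j2: "j \<ge> 2" using kt(3) by (auto simp: j_def)
  obtain e :: "nat \<Rightarrow> 'a set" where e: "\<And>i. i \<in> {1..j} \<Longrightarrow> e i \<in> E"
    "\<And>f. (\<And>i. i \<in> {1..j} \<Longrightarrow> f i \<in> E) \<Longrightarrow> card (\<Inter>i\<in>{1..j}. e i) \<le> card (\<Inter>i\<in>{1..j}. f i)"
    using minimal_family_exists[OF False, where I = "{1..j}"] by blast
  define A where "A = (\<Inter>i\<in>{1..j}. e i)"
  define s where "s = card A"
  have e1: "e 1 \<in> E" "A \<subseteq> e 1" using e(1)[of 1] j2 by (auto simp: A_def)
  have AV: "A \<subseteq> V" using e1 H(1) unfolding hypergraph_def by blast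
  have finA: "finite A" using e1 fin finite_subset by blast
  have "card (p ` A) \<le> card {1..r}" using e1 p(2) by (intro card_mono) blast+
  moreover have "card (p ` A) = card A" using e1 p(1) by (meson card_image inj_on_subset)
  ultimately have sr: "s \<le> r" by (simp add: s_def)
  have overlap: "s - (r - s) div j \<le> card (h \<inter> A)" if "h \<in> E" for h
  proof -
    have "j * (s - card (h \<inter> A)) \<le> r - s"
      using minimal_family_edge_overlap[OF p fin _ _ e that A_def] j2 by (simp add: s_def)
    then have "s - card (h \<inter> A) \<le> (r - s) div j"
      using j2 by (simp add: less_eq_div_iff_mult_less_eq mult.commute)
    then show ?thesis by linarith
  qed
  \<comment> \<open>The first condition makes the overlap \<open>c = s - (r - s) div j\<close>
    positive; then \<open>s - c + 1 = (r - s) div j + 1\<close>.\<close>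
  have cover_div: thesis if "r - s < j * s" "(r - s) div j \<le> (r - t) div k"
  proof -
    have lt: "(r - s) div j < s" using that(1) j2 by (simp add: div_less_iff_less_mult mult.commute)
    obtain C where C: "cover V E C" "card C = card A - (s - (r - s) div j) + 1"
      by (rule cover_from_overlap[OF AV finA _ _ overlap]) (use lt in \<open>auto simp: s_def\<close>)
    then have "card C \<le> (r - t) div k + 1" using lt that(2) by (simp add: s_def)
    with C(1) show thesis by (rule found)
  qed
  show thesis
  proof (cases "k = 2")
    case True
    then have "j = 2" by (simp add: j_def)
    have "t \<le> card (\<Inter>i\<in>{1..k}. e i)"
      using H(3) e(1) True \<open>j = 2\<close> unfolding wise_intersecting_def by blast
    then have "t \<le> s" using True \<open>j = 2\<close> by (simp add: s_def A_def)
    show thesis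
    proof (rule cover_div)
      \<comment> \<open>Here \<open>t > r / 3\<close> enters:
        \<open>r - s \<le> r - t < 2 * t \<le> 2 * s\<close>.\<close>
      show "r - s < j * s" using \<open>t \<le> s\<close> \<open>j = 2\<close> kt True by simp
      show "(r - s) div j \<le> (r - t) div k" using \<open>t \<le> s\<close> \<open>j = 2\<close> True by (simp add: div_le_mono)
    qed
  next
    case False
    then have k: "k \<ge> 3" "k = Suc j" using kt(3) by (auto simp: j_def)
    have meet: "t \<le> card (h \<inter> A)" if "h \<in> E" for h
    proof -
      have "\<forall>i\<in>{1..k}. (e(k := h)) i \<in> E" using that e(1) k(2) by auto
      then have "t \<le> card (\<Inter>i\<in>{1..k}. (e(k := h)) i)"
        using H(3) unfolding wise_intersecting_def by blast
      also have "(\<Inter>i\<in>{1..k}. (e(k := h)) i) = h \<inter> A"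
        unfolding A_def k(2) by (auto simp: atLeastAtMostSuc_conv)
      finally show ?thesis .
    qed
    have ts: "t \<le> s"
      using meet[OF e1(1)] e1(2) by (simp add: s_def Int_absorb1)
    show thesis
    proof (cases "s - t \<le> (r - t) div k")
      case True
      obtain C where C: "cover V E C" "card C = card A - t + 1"
        by (rule cover_from_overlap[OF AV finA _ _ meet]) (use ts kt in \<open>auto simp: s_def\<close>)
      then show thesis using that True by (simp add: s_def)
    next
      case False
      then have "(r - t) div k < s - t" by simp
      then have "r - t < (s - t) * k" using k by (simp add: div_less_iff_less_mult)
      \<comment> \<open>Subtract \<open>s - t\<close> from both sides and use
        \<open>k = j + 1\<close>.\<close>
      then have lt: "r - s < j * (s - t)" using ts sr k(2) by (simp add: algebra_simps)
      show thesis
      proof (rule cover_div)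
        have "j * (s - t) \<le> j * s" by simp
        then show "r - s < j * s" using lt by linarith
        define q where "q = (r - s) div j"
        have "q < s - t" unfolding q_def using lt j2
          by (simp add: div_less_iff_less_mult mult.commute)
        moreover have "q * j \<le> r - s" unfolding q_def by simp
        \<comment> \<open>Add the two bounds:
          \<open>q * j + q \<le> (r - s) + (s - t)\<close>.\<close>
        ultimately have "q * k \<le> r - t" using k(2) ts sr by simp
        then show "(r - s) div j \<le> (r - t) div k"
          using k by (simp add: q_def less_eq_div_iff_mult_less_eq)
      qed
    qed
  qed
qed

text \<open>The \<open>LEAST\<close> in \<open>cover_number\<close> is meaningful only once some
  cover is known.\<close>

lemma cover_number_attained:
  assumes "cover V E C"
  obtains D where "cover V E D" "card D = cover_number V E" "cover_number V E \<le> card C"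
proof -
  have ex: "\<exists>D. cover V E D \<and> card D = card C" using assms by blast
  have "\<exists>D. cover V E D \<and> card D = cover_number V E"
    unfolding cover_number_def by (rule LeastI) (rule ex)
  moreover have "cover_number V E \<le> card C"
    unfolding cover_number_def by (rule Least_le) (rule ex)
  ultimately show thesis using that by blast
qed

section \<open>Sharpness: words with few nonzero letters\<close>

text \<open>Vertices are pairs (position, letter); a word \<open>w\<close> is identified with its graph.\<close>

definition word_edge :: "nat \<Rightarrow> (nat \<Rightarrow> nat) \<Rightarrow> nat set" where
  "word_edge r w = (\<lambda>j. prod_encode (j, w j)) ` {1..r}"

text \<open>Pairs are coded as numbers so that the example lives on \<open>nat\<close>.\<close>

definition word_vertices :: "nat \<Rightarrow> nat \<Rightarrow> nat set" where
  "word_vertices r m = prod_encode ` ({1..r} \<times> {..Suc m})"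

definition word_edges :: "nat \<Rightarrow> nat \<Rightarrow> nat set set" where
  "word_edges r m =
     word_edge r ` {w. (\<forall>j\<in>{1..r}. w j \<le> Suc m) \<and> card {j\<in>{1..r}. w j \<noteq> 0} \<le> m}"

lemma word_edges_E:
  assumes "e \<in> word_edges r m"
  obtains w where "e = word_edge r w" "\<And>j. j \<in> {1..r} \<Longrightarrow> w j \<le> Suc m"
    "card {j\<in>{1..r}. w j \<noteq> 0} \<le> m"
  using assms unfolding word_edges_def by blast

lemma prod_encode_in_word_edge: "prod_encode (j, c) \<in> word_edge r w \<longleftrightarrow> j \<in> {1..r} \<and> c = w j"
  unfolding word_edge_def by (auto simp: prod_encode_eq)

lemma hypergraph_words: "hypergraph (word_vertices r m) (word_edges r m)"
  unfolding hypergraph_def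
proof (intro conjI ballI)
  show "finite (word_vertices r m)" unfolding word_vertices_def by simp
  fix e assume "e \<in> word_edges r m"
  then show "e \<subseteq> word_vertices r m"
    by (rule word_edges_E) (auto simp: word_edge_def word_vertices_def)
qed

lemma uniform_words: "uniform r (word_edges r m)"
  unfolding uniform_def
proof
  fix e assume "e \<in> word_edges r m"
  then obtain w where "e = word_edge r w" by (rule word_edges_E)
  then show "card e = r"
    unfolding word_edge_def by (simp add: card_image inj_on_def prod_encode_eq)
qed

lemma partite_words: "partite r (word_vertices r m) (word_edges r m)"
  unfolding partite_def
proof (intro exI conjI ballI)
  let ?P = "\<lambda>j. prod_encode ` ({j} \<times> {..Suc m})"
  show "word_vertices r m = (\<Union>j\<in>{1..r}. ?P j)" unfolding word_vertices_def by blast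
  show "disjoint_family_on ?P {1..r}"
    unfolding disjoint_family_on_def by (auto simp: prod_encode_eq)
  fix e j assume "e \<in> word_edges r m" and j: "j \<in> {1..r}"
  then obtain w where "e = word_edge r w" "w j \<le> Suc m" by (metis word_edges_E)
  then have "e \<inter> ?P j = {prod_encode (j, w j)}"
    using j by (auto simp: prod_encode_in_word_edge)
  then show "card (e \<inter> ?P j) = 1" by simp
qed

text \<open>Each word is nonzero at no more than \<open>m\<close> positions, so \<open>k\<close>
  words vanish together at \<open>r - k * m\<close> or more positions, and each of these gives a
  common vertex.\<close>

lemma wise_intersecting_words:
  assumes "k > 0" "k * m + t \<le> r"
  shows "wise_intersecting k t (word_edges r m)"
  unfolding wise_intersecting_def
proof (intro allI impI)
  fix e :: "nat \<Rightarrow> nat set" assume e: "\<forall>i\<in>{1..k}. e i \<in> word_edges r m"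
  then have "\<forall>i\<in>{1..k}. \<exists>w. e i = word_edge r w \<and> card {j\<in>{1..r}. w j \<noteq> 0} \<le> m"
    by (metis word_edges_E)
  then obtain w where w: "\<And>i. i \<in> {1..k} \<Longrightarrow> e i = word_edge r (w i)"
    "\<And>i. i \<in> {1..k} \<Longrightarrow> card {j\<in>{1..r}. w i j \<noteq> 0} \<le> m"
    by metis
  define Z where "Z = {1..r} - (\<Union>i\<in>{1..k}. {j\<in>{1..r}. w i j \<noteq> 0})"
  have "card (\<Union>i\<in>{1..k}. {j\<in>{1..r}. w i j \<noteq> 0}) \<le> (\<Sum>i\<in>{1..k}. card {j\<in>{1..r}. w i j \<noteq> 0})"
    by (rule card_UN_le) simp
  also have "\<dots> \<le> k * m"
    using sum_bounded_above[of "{1..k}" "\<lambda>i. card {j\<in>{1..r}. w i j \<noteq> 0}" m] w(2) by simp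
  finally have "t \<le> r - card (\<Union>i\<in>{1..k}. {j\<in>{1..r}. w i j \<noteq> 0})" using assms(2) by linarith
  also have "\<dots> \<le> card Z"
    unfolding Z_def
    using diff_card_le_card_Diff[of "\<Union>i\<in>{1..k}. {j\<in>{1..r}. w i j \<noteq> 0}" "{1..r}"] by auto
  also have "\<dots> = card ((\<lambda>j. prod_encode (j, 0)) ` Z)"
    by (simp add: card_image inj_on_def prod_encode_eq)
  also have "\<dots> \<le> card (\<Inter>i\<in>{1..k}. e i)"
  proof (rule card_mono)
    have "finite (e 1)" using w(1)[of 1] assms(1) by (simp add: word_edge_def)
    moreover have "(\<Inter>i\<in>{1..k}. e i) \<subseteq> e 1" using assms(1) by auto
    ultimately show "finite (\<Inter>i\<in>{1..k}. e i)" by (rule rev_finite_subset)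
    show "(\<lambda>j. prod_encode (j, 0)) ` Z \<subseteq> (\<Inter>i\<in>{1..k}. e i)"
      using w(1) by (auto simp: Z_def prod_encode_in_word_edge)
  qed
  finally show "t \<le> card (\<Inter>i\<in>{1..k}. e i)" .
qed

text \<open>Against a set of at most \<open>m\<close> vertices, choose at each position the least
  letter that avoids it. A nonzero choice at \<open>j\<close> means that the vertex
  \<open>(j, 0)\<close> is in the set, so at most \<open>m\<close> letters are nonzero and the word
  is an uncovered edge.\<close>

lemma card_cover_words:
  assumes "cover (word_vertices r m) (word_edges r m) C"
  shows "m < card C"
proof (rule ccontr)
  assume small: "\<not> m < card C"
  have finC: "finite C"
    using assms hypergraph_words finite_subset unfolding cover_def hypergraph_def by metis
  \<comment> \<open>Pigeonhole: \<open>m + 2\<close> letters against at most \<open>m\<close>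
    vertices.\<close>
  have free: "\<exists>c \<le> Suc m. prod_encode (j, c) \<notin> C" for j
  proof (rule ccontr)
    assume "\<not> ?thesis"
    then have "(\<lambda>c. prod_encode (j, c)) ` {..Suc m} \<subseteq> C" by auto
    then have "card ((\<lambda>c. prod_encode (j, c)) ` {..Suc m}) \<le> card C"
      using finC by (rule card_mono[rotated])
    then show False using small by (simp add: card_image inj_on_def prod_encode_eq)
  qed
  define w where "w j = (LEAST c. prod_encode (j, c) \<notin> C)" for j
  have w: "prod_encode (j, w j) \<notin> C" for j
    unfolding w_def using free[of j] by (metis LeastI)
  have w_le: "w j \<le> Suc m" for j
    unfolding w_def using free[of j] by (meson Least_le le_trans)
  have zero: "prod_encode (j, 0) \<in> C" if "w j \<noteq> 0" for j
    using that unfolding w_def by (metis Least_le le_zero_eq)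
  have "card {j\<in>{1..r}. w j \<noteq> 0} \<le> card C"
    by (rule card_inj_on_le[of "\<lambda>j. prod_encode (j, 0)"])
      (use zero finC in \<open>auto simp: inj_on_def prod_encode_eq\<close>)
  then have "word_edge r w \<in> word_edges r m"
    unfolding word_edges_def using small w_le by auto
  then have "C \<inter> word_edge r w \<noteq> {}" using assms unfolding cover_def by blast
  then show False using w by (auto simp: word_edge_def)
qed

theorem theorem1p7:
  fixes r k t :: nat
  assumes "r > 0" and "k > 0" and "t > 0" and "t \<le> r"
    and "(k \<ge> 3 \<and> t \<ge> 1) \<or> (k = 2 \<and> real t > real r / 3)"
  shows "(\<forall>(V :: 'a set) E.
            hypergraph V E \<and> uniform r E \<and> partite r V E \<and> wise_intersecting k t E \<longrightarrow>
              int (cover_number V E) \<le> \<lfloor>(real r - real t) / real k\<rfloor> + 1) \<and>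
         (\<exists>(V :: nat set) E.
            hypergraph V E \<and> uniform r E \<and> partite r V E \<and> wise_intersecting k t E \<and>
              int (cover_number V E) = \<lfloor>(real r - real t) / real k\<rfloor> + 1)"
proof -
  have kt: "k \<ge> 3 \<or> (k = 2 \<and> r < 3 * t)" using assms(5) by auto
  note small = small_cover_exists[OF assms(3,4) kt]
  define m where "m = (r - t) div k"
  \<comment> \<open>Since \<open>t \<le> r\<close>, truncated subtraction agrees with the real
    difference.\<close>
  have fl: "\<lfloor>(real r - real t) / real k\<rfloor> = int m"
    using floor_divide_of_nat_eq[of "r - t" k] assms(4) by (simp add: m_def of_nat_diff)
  have upper: "int (cover_number V E) \<le> int m + 1"
    if H: "hypergraph V E" "partite r V E" "wise_intersecting k t E" for V :: "'a set" and E
  proof -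
    obtain C where "cover V E C" "card C \<le> m + 1" using small[OF H] unfolding m_def by blast
    then show ?thesis using cover_number_attained[of V E C] by fastforce
  qed
  let ?V = "word_vertices r m" and ?E = "word_edges r m"
  have "k * m \<le> r - t" unfolding m_def by simp
  then have wise: "wise_intersecting k t ?E"
    using assms(2,4) by (intro wise_intersecting_words) auto
  \<comment> \<open>The upper bound, applied to the example itself, supplies a cover; a minimum
    cover \<open>D\<close> then has more than \<open>m\<close> vertices by
    \<open>card_cover_words\<close>.\<close>
  obtain C where C: "cover ?V ?E C" "card C \<le> m + 1"
    using small[OF hypergraph_words partite_words wise] unfolding m_def by blast
  then obtain D where "cover ?V ?E D" "card D = cover_number ?V ?E" "cover_number ?V ?E \<le> card C"
    using cover_number_attained by blast
  then have "int (cover_number ?V ?E) = int m + 1"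
    using card_cover_words[of r m D] C(2) by linarith
  then show ?thesis
    unfolding fl using upper hypergraph_words uniform_words partite_words wise by blast
qed

end
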